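(* Let $0<\mu\le L$ and $f\in\mathcal S^1_{\mu,L}$. Let $s>0$, $q=\mu s$, and let $\eta,\nu,\tau$ be real numbers such that $0\le\eta s\le1/L$, $\nu\ge0$, $1-\nu\sqrt q>0$, $\tau>0$ and $\zeta:=1+(1-\tau)\sqrt q\ge0$. Define $$\mathbf I=\zeta\nu(\tau+\zeta\eta\sqrt q)-\tau^2,\qquad\mathbf{II}=\tau(\nu\tau-2\zeta\eta)+\zeta\eta(\nu\tau-\zeta\eta)\sqrt q,$$ and, for the iterates of algorithm $(\mathcal A)$ (defined in the context) and $k\ge0$, $$V_{k+1}=\frac{\zeta\nu}{\tau^2}(\tau+\zeta\eta\sqrt q)\Big(f(x_k)-f^*-\frac{\eta s}{2}\|\nabla f(x_k)\|^2\Big)+\frac\mu2\|z_{k+1}-x^*\|^2.$$ If one of the following (mutually exclusive) conditions holds: (i) $\mathbf I>0$ and $\mathbf I+\sqrt q\,\mathbf{II}\le0$; (ii) $\mathbf{II}>0$ and $\frac\mu L\mathbf I+\sqrt q\,\mathbf{II}\le0$; (iii) $\mathbf I\le0$ and $\mathbf{II}\le0$; then $V_{k+1}\le(1-\nu\sqrt q)V_k$ for all $k\ge1$.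
   Context: For $0<\mu\le L$, $\mathcal S^1_{\mu,L}$ is the set of continuously differentiable convex functions $f:\mathbb R^n\to\mathbb R$ that are $L$-smooth ($\|\nabla f(y)-\nabla f(x)\|\le L\|y-x\|$ for all $x,y$) and $\mu$-strongly convex ($f(y)\ge f(x)+\langle\nabla f(x),y-x\rangle+\frac{\mu}{2}\|y-x\|^2$ for all $x,y$); $\|\cdot\|$ is the Euclidean norm. $x^*$ is the unique minimizer of $f$ and $f^*=f(x^* )$. Algorithm $(\mathcal A)$ with parameters $\eta,\nu,\tau\ge0$: starting from $x_0=z_0\in\mathbb R^n$, for $k\ge0$, $$y_{k+1}=x_k-\eta s\nabla f(x_k),$$ $$z_{k+1}=\nu\sqrt q\,\Big(x_k-\frac1\mu\nabla f(x_k)\Big)+(1-\nu\sqrt q)z_k,$$ $$x_{k+1}=\frac{\tau\sqrt q}{1+\sqrt q}z_{k+1}+\Big(1-\frac{\tau\sqrt q}{1+\sqrt q}\Big)y_{k+1}.$$ *)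

theory Defs
  imports "HOL-Analysis.Analysis"
begin

text \<open>The gradient with respect to the Euclidean inner product; it is unspecified where the
  function is not differentiable.\<close>

definition grad :: "(real ^ 'n \<Rightarrow> real) \<Rightarrow> real ^ 'n \<Rightarrow> real ^ 'n" where
  "grad f x = (THE D. GDERIV f x :> D)"

lemma GDERIV_grad:
  fixes f :: "real ^ 'n \<Rightarrow> real"
  assumes "f differentiable (at x)"
  shows "GDERIV f x :> grad f x"
proof -
  obtain f' where f': "(f has_derivative f') (at x)"
    using assms by (auto simp: differentiable_def)
  define D where "D = (\<Sum>b\<in>Basis. f' b *\<^sub>R b)"
  have lin: "linear f'"
    using f' by (rule has_derivative_linear)
  have "f' h = h \<bullet> D" for h
  proof -
    have "f' h = f' (\<Sum>b\<in>Basis. (h \<bullet> b) *\<^sub>R b)"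
      by (simp add: euclidean_representation)
    also have "\<dots> = (\<Sum>b\<in>Basis. (h \<bullet> b) * f' b)"
      by (simp add: linear_sum[OF lin] linear_scale[OF lin])
    also have "\<dots> = h \<bullet> D"
      by (simp add: D_def inner_sum_right mult.commute)
    finally show ?thesis .
  qed
  then have "f' = (\<lambda>h. h \<bullet> D)"
    by (rule ext)
  with f' have D: "GDERIV f x :> D"
    by (simp add: gderiv_def)
  have "D' = D" if "GDERIV f x :> D'" for D'
  proof -
    have "(\<lambda>h. h \<bullet> D') = (\<lambda>h. h \<bullet> D)"
      using that D unfolding gderiv_def by (rule has_derivative_unique)
    then show ?thesis
      by (metis vector_eq_rdot inner_commute)
  qed
  with D show ?thesis
    unfolding grad_def by (rule theI)
qed

definition smooth_strongly_convex :: "real \<Rightarrow> real \<Rightarrow> (real ^ 'n \<Rightarrow> real) set" where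
  "smooth_strongly_convex \<mu> L = {f.
     (\<forall>x. f differentiable (at x)) \<and> continuous_on UNIV (grad f) \<and>
     convex_on UNIV f \<and>
     (\<forall>x y. norm (grad f y - grad f x) \<le> L * norm (y - x)) \<and>
     (\<forall>x y. f y \<ge> f x + grad f x \<bullet> (y - x) + \<mu> / 2 * (norm (y - x))\<^sup>2)}"

text \<open>The value \<^term>\<open>y 0\<close> plays no role in the algorithm and is left unconstrained.\<close>

definition algorithm_A ::
  "(real ^ 'n \<Rightarrow> real) \<Rightarrow> real \<Rightarrow> real \<Rightarrow> real \<Rightarrow> real \<Rightarrow> real \<Rightarrow>
   (nat \<Rightarrow> real ^ 'n) \<Rightarrow> (nat \<Rightarrow> real ^ 'n) \<Rightarrow> (nat \<Rightarrow> real ^ 'n) \<Rightarrow> bool" where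
  "algorithm_A f \<mu> s \<eta> \<nu> \<tau> x y z \<longleftrightarrow> (let q = \<mu> * s in
     x 0 = z 0 \<and>
     (\<forall>k. y (Suc k) = x k - (\<eta> * s) *\<^sub>R grad f (x k) \<and>
          z (Suc k) = (\<nu> * sqrt q) *\<^sub>R (x k - (1 / \<mu>) *\<^sub>R grad f (x k))
                      + (1 - \<nu> * sqrt q) *\<^sub>R z k \<and>
          x (Suc k) = (\<tau> * sqrt q / (1 + sqrt q)) *\<^sub>R z (Suc k)
                      + (1 - \<tau> * sqrt q / (1 + sqrt q)) *\<^sub>R y (Suc k)))"

text \<open>Existence and uniqueness of the minimizer make \<^term>\<open>arg_min f (\<lambda>_. True)\<close> meaningful.\<close>

lemma ex1_minimizer:
  fixes f :: "real ^ 'n \<Rightarrow> real"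
  assumes "\<mu> > 0" and f: "f \<in> smooth_strongly_convex \<mu> L"
  shows "\<exists>!x. is_arg_min f (\<lambda>_. True) x"
proof -
  have sc: "f y \<ge> f x + grad f x \<bullet> (y - x) + \<mu> / 2 * (norm (y - x))\<^sup>2" for x y
    using f by (auto simp: smooth_strongly_convex_def)
  have cont: "continuous_on UNIV f"
    using f by (auto simp: smooth_strongly_convex_def continuous_on_eq_continuous_at
        intro: differentiable_imp_continuous_within)
  define R where "R = 2 * norm (grad f 0) / \<mu>"
  have "R \<ge> 0"
    using \<open>\<mu> > 0\<close> by (simp add: R_def)
  have "\<exists>x\<in>cball 0 R. \<forall>y\<in>cball 0 R. f x \<le> f y"
    using \<open>R \<ge> 0\<close> continuous_on_subset[OF cont] by (intro continuous_attains_inf) auto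
  then obtain x where x: "\<And>y. norm y \<le> R \<Longrightarrow> f x \<le> f y"
    by (metis mem_cball_0)
  have min: "f x \<le> f y" for y
  proof (cases "norm y \<le> R")
    case False
    have "norm (grad f 0) * norm y \<le> \<mu> / 2 * (norm y)\<^sup>2"
    proof -
      have "norm (grad f 0) \<le> \<mu> / 2 * norm y"
        using False \<open>\<mu> > 0\<close> by (simp add: R_def field_simps)
      then show ?thesis
        using mult_right_mono[of _ _ "norm y"] by (fastforce simp: power2_eq_square)
    qed
    moreover have "\<bar>grad f 0 \<bullet> y\<bar> \<le> norm (grad f 0) * norm y"
      by (rule Cauchy_Schwarz_ineq2)
    ultimately have "f 0 \<le> f y"
      using sc[where x = 0 and y = y] by simp
    with x[of 0] \<open>R \<ge> 0\<close> show ?thesis by simp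
  qed (rule x)
  have "u = v" if u: "\<And>y. f u \<le> f y" and v: "\<And>y. f v \<le> f y" for u v
  proof -
    define m where "m = (1 / 2) *\<^sub>R (u + v)"
    have um: "u - m = (1 / 2) *\<^sub>R (u - v)" and vm: "v - m = - ((1 / 2) *\<^sub>R (u - v))"
      by (simp_all add: m_def vec_eq_iff field_simps)
    have "f u + f v \<ge> 2 * f m + \<mu> * (norm ((1 / 2) *\<^sub>R (u - v)))\<^sup>2"
      using sc[where x = m and y = u] sc[where x = m and y = v]
      unfolding um vm norm_minus_cancel inner_minus_right by linarith
    with u[of m] v[of m] have "\<mu> * (norm ((1 / 2) *\<^sub>R (u - v)))\<^sup>2 \<le> 0"
      by linarith
    with \<open>\<mu> > 0\<close> show ?thesis
      by (simp add: mult_le_0_iff)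
  qed
  with min show ?thesis
    by (auto simp: is_arg_min_linorder)
qed

end

theory Submission
  imports Defs
begin

text \<open>
  Write \<open>r = sqrt q\<close>, \<open>g = \<nabla>f(x\<^sub>k)\<close> and \<open>d = x\<^sub>k - y\<^sub>k\<close>. For \<open>k \<ge> 1\<close> the definition of \<open>x\<^sub>k\<close> reads
  \<open>\<tau> r (z\<^sub>k - x\<^sub>k) = \<zeta> d\<close>. Expanding the square in \<open>V\<^sub>k\<^sub>+\<^sub>1\<close>, bounding \<open>f(x\<^sup>*)\<close> from below by strong
  convexity at \<open>x\<^sub>k\<close>, bounding \<open>f(x\<^sub>k\<^sub>-\<^sub>1)\<close> from below by the cocoercivity inequality, and completing
  the square in \<open>d\<close> leaves
  \<open>V\<^sub>k\<^sub>+\<^sub>1 - (1 - \<nu> r) V\<^sub>k \<le> \<nu> r / \<tau>\<^sup>2 (I (f(x\<^sub>k) - f(x\<^sup>*)) + r II \<parallel>g\<parallel>\<^sup>2 / (2 \<mu>))\<close>.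
  The right-hand side is nonpositive in each of the three cases since
  \<open>\<parallel>g\<parallel>\<^sup>2 / (2 L) \<le> f(x\<^sub>k) - f(x\<^sup>*) \<le> \<parallel>g\<parallel>\<^sup>2 / (2 \<mu>)\<close>.
\<close>

section \<open>Inequalities from smoothness and strong convexity\<close>

text \<open>Subtract from \<open>f\<close> along the segment from \<open>u\<close> to
  \<open>v\<close> the linear and quadratic terms of the bound. By Cauchy-Schwarz and the Lipschitz
  gradient the resulting function \<open>\<psi>\<close> has nonpositive derivative for
  \<open>t \<ge> 0\<close>, and the claim is \<open>\<psi> 1 \<le> \<psi> 0\<close>.\<close>

lemma descent_lemma:
  fixes f :: "real ^ 'n \<Rightarrow> real"
  assumes diff: "\<And>x. f differentiable (at x)"
    and lip: "\<And>x y. norm (grad f y - grad f x) \<le> L * norm (y - x)"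
  shows "f v \<le> f u + grad f u \<bullet> (v - u) + L / 2 * (norm (v - u))\<^sup>2"
proof -
  define d where "d = v - u"
  define \<psi> where "\<psi> t = f (u + t *\<^sub>R d) - t * (grad f u \<bullet> d) - L / 2 * t\<^sup>2 * (norm d)\<^sup>2" for t
  have der: "(\<psi> has_real_derivative
      (d \<bullet> grad f (u + t *\<^sub>R d) - grad f u \<bullet> d - L * t * (norm d)\<^sup>2)) (at t)" for t
  proof -
    have f': "(f has_derivative (\<lambda>h. h \<bullet> grad f (u + t *\<^sub>R d))) (at (u + t *\<^sub>R d))"
      using GDERIV_grad[OF diff] by (simp add: gderiv_def)
    have "((\<lambda>t. u + t *\<^sub>R d) has_derivative (\<lambda>h. h *\<^sub>R d)) (at t)"
      by (auto intro!: derivative_eq_intros)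
    from has_derivative_compose[OF this f']
    have "((\<lambda>t. f (u + t *\<^sub>R d)) has_real_derivative (d \<bullet> grad f (u + t *\<^sub>R d))) (at t)"
      by (simp add: has_field_derivative_def mult_commute_abs)
    then show ?thesis
      unfolding \<psi>_def by (auto intro!: derivative_eq_intros)
  qed
  have "d \<bullet> grad f (u + t *\<^sub>R d) - grad f u \<bullet> d - L * t * (norm d)\<^sup>2 \<le> 0" if "0 \<le> t" for t
  proof -
    have "d \<bullet> (grad f (u + t *\<^sub>R d) - grad f u) \<le> norm d * norm (grad f (u + t *\<^sub>R d) - grad f u)"
      by (rule norm_cauchy_schwarz)
    also have "\<dots> \<le> norm d * (L * norm (t *\<^sub>R d))"
      using lip[of "u + t *\<^sub>R d" u] by (intro mult_left_mono) auto
    also have "\<dots> = L * t * (norm d)\<^sup>2"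
      using that by (simp add: power2_eq_square)
    finally show ?thesis
      by (simp add: inner_diff_right inner_commute[of d "grad f u"])
  qed
  with der have "\<psi> 1 \<le> \<psi> 0"
    by (intro DERIV_nonpos_imp_nonincreasing[of 0 1]) (simp, blast)
  then show ?thesis
    by (simp add: \<psi>_def d_def)
qed

text \<open>The step length \<open>1 / L\<close> minimizes the quadratic upper bound of
  \<open>descent_lemma\<close> along the negative gradient. Compared with the minimum value, this
  bounds the gap below by the squared gradient.\<close>

lemma gradient_step_decrease:
  fixes f :: "real ^ 'n \<Rightarrow> real"
  assumes "L > 0" and diff: "\<And>x. f differentiable (at x)"
    and lip: "\<And>x y. norm (grad f y - grad f x) \<le> L * norm (y - x)"
  shows "f (x - (1 / L) *\<^sub>R grad f x) \<le> f x - (norm (grad f x))\<^sup>2 / (2 * L)"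
proof -
  define g where "g = grad f x"
  have "g \<bullet> ((x - (1 / L) *\<^sub>R g) - x) = - ((norm g)\<^sup>2 / L)"
    by (simp add: power2_norm_eq_inner)
  moreover have "L / 2 * (norm ((x - (1 / L) *\<^sub>R g) - x))\<^sup>2 = (norm g)\<^sup>2 / L / 2"
    using \<open>L > 0\<close> by (simp add: power_divide field_simps power2_eq_square)
  ultimately show ?thesis
    using descent_lemma[OF diff lip, of "x - (1 / L) *\<^sub>R g" x]
    unfolding g_def[symmetric] mult.commute[of 2 L] divide_divide_eq_left[symmetric] by linarith
qed

text \<open>Take a gradient step of length \<open>1 / L\<close> from \<open>p\<close> for
  \<open>f\<close> minus its linear part at \<open>x\<close>, ending at \<open>w\<close>. The
  descent lemma at \<open>p\<close> bounds \<open>f w\<close> above, the tangent at \<open>x\<close>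
  bounds it below; the terms in \<open>grad f x \<bullet> e\<close> cancel.\<close>

lemma cocoercivity:
  fixes f :: "real ^ 'n \<Rightarrow> real"
  assumes "L > 0" and diff: "\<And>x. f differentiable (at x)"
    and lip: "\<And>x y. norm (grad f y - grad f x) \<le> L * norm (y - x)"
    and above_tangent: "\<And>x y. f x + grad f x \<bullet> (y - x) \<le> f y"
  shows "f x + grad f x \<bullet> (p - x) + (norm (grad f p - grad f x))\<^sup>2 / (2 * L) \<le> f p"
proof -
  define e where "e = grad f p - grad f x"
  define w where "w = p - (1 / L) *\<^sub>R e"
  have "f w \<le> f p + grad f p \<bullet> (w - p) + L / 2 * (norm (w - p))\<^sup>2"
    by (rule descent_lemma[OF diff lip])
  moreover have "f x + grad f x \<bullet> (w - x) \<le> f w"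
    by (rule above_tangent)
  moreover have "grad f x \<bullet> (w - x) = grad f x \<bullet> (p - x) - (grad f x \<bullet> e) / L"
    by (simp add: w_def inner_diff_right)
  moreover have "grad f p \<bullet> (w - p) = - ((grad f x \<bullet> e) / L) - (norm e)\<^sup>2 / L"
    by (simp add: w_def e_def power2_norm_eq_inner inner_diff_left inner_diff_right
        inner_commute[of "grad f p" "grad f x"] add_divide_distrib diff_divide_distrib)
  moreover have "L / 2 * (norm (w - p))\<^sup>2 = (norm e)\<^sup>2 / L / 2"
    using \<open>L > 0\<close> by (simp add: w_def power_divide field_simps power2_eq_square)
  ultimately show ?thesis
    unfolding e_def[symmetric] by (simp add: mult.commute[of 2])
qed

text \<open>Completing the square in \<open>d\<close>: the quadratic lower model has minimum
  \<open>F - (norm g)\<^sup>2 / (2 * \<mu>)\<close>.\<close>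

lemma strong_convexity_gap_le:
  fixes g d :: "'a::real_inner"
  assumes "\<mu> > 0" and "F + g \<bullet> d + \<mu> / 2 * (norm d)\<^sup>2 \<le> F'"
  shows "F - F' \<le> (norm g)\<^sup>2 / (2 * \<mu>)"
proof -
  have "0 \<le> (norm (g + \<mu> *\<^sub>R d))\<^sup>2 / (2 * \<mu>)"
    using \<open>\<mu> > 0\<close> by simp
  also have "\<dots> = (norm g)\<^sup>2 / (2 * \<mu>) + g \<bullet> d + \<mu> / 2 * (norm d)\<^sup>2"
    using \<open>\<mu> > 0\<close>
    by (simp add: power2_norm_eq_inner inner_add_left inner_add_right inner_commute field_simps)
  finally show ?thesis
    using assms(2) by linarith
qed

section \<open>Norm identities and the one-step estimate\<close>

lemma norm_convex_combination:
  fixes a b :: "'a::real_inner"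
  shows "(norm (t *\<^sub>R a + (1 - t) *\<^sub>R b))\<^sup>2
    = t * (norm a)\<^sup>2 + (1 - t) * (norm b)\<^sup>2 - t * (1 - t) * (norm (b - a))\<^sup>2"
  by (simp add: power2_norm_eq_inner inner_add_left inner_add_right inner_diff_left
      inner_diff_right inner_commute algebra_simps)

lemma norm_diff_scaleR_square:
  fixes a b :: "'a::real_inner"
  shows "(norm (a - t *\<^sub>R b))\<^sup>2 = (norm a)\<^sup>2 - 2 * t * (b \<bullet> a) + t\<^sup>2 * (norm b)\<^sup>2"
  unfolding power2_norm_eq_inner
  by (simp add: inner_diff_left inner_diff_right inner_commute[of a b] power2_eq_square algebra_simps)

text \<open>Relative to \<open>u\<close>, the new \<open>z\<close> is the affine combination
  \<open>c\<close> of \<open>x - u\<close> and \<open>z - u\<close>, shifted by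
  \<open>(t / \<mu>) *\<^sub>R g\<close>. Expand the shift first, then the combination.\<close>

lemma z_step_distance:
  fixes x z g u :: "'a::real_inner"
  assumes "\<mu> > 0"
  shows "\<mu> / 2 * (norm (t *\<^sub>R (x - (1 / \<mu>) *\<^sub>R g) + (1 - t) *\<^sub>R z - u))\<^sup>2
    = (1 - t) * (\<mu> / 2 * (norm (z - u))\<^sup>2) + t * (g \<bullet> (u - x) + \<mu> / 2 * (norm (u - x))\<^sup>2)
      - t * (1 - t) * (\<mu> / 2 * (norm (z - x))\<^sup>2 + g \<bullet> (z - x)) + t\<^sup>2 / (2 * \<mu>) * (norm g)\<^sup>2"
proof -
  define a b where "a = x - u" and "b = z - u"
  define c where "c = t *\<^sub>R a + (1 - t) *\<^sub>R b"
  have "t *\<^sub>R (x - (1 / \<mu>) *\<^sub>R g) + (1 - t) *\<^sub>R z - u = c - (t / \<mu>) *\<^sub>R g"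
    by (simp add: a_def b_def c_def algebra_simps)
  moreover have "\<mu> / 2 * (norm (c - (t / \<mu>) *\<^sub>R g))\<^sup>2
      = \<mu> / 2 * (norm c)\<^sup>2 - t * (g \<bullet> c) + t\<^sup>2 / (2 * \<mu>) * (norm g)\<^sup>2"
    using assms unfolding norm_diff_scaleR_square by (simp add: field_simps power2_eq_square)
  moreover have "(norm c)\<^sup>2
      = t * (norm a)\<^sup>2 + (1 - t) * (norm b)\<^sup>2 - t * (1 - t) * (norm (b - a))\<^sup>2"
    unfolding c_def by (rule norm_convex_combination)
  moreover have "g \<bullet> c = g \<bullet> a + (1 - t) * (g \<bullet> (b - a))"
    by (simp add: c_def inner_add_right inner_diff_right algebra_simps)
  moreover have "z - x = b - a" "z - u = b" "u - x = - a"
    by (simp_all add: a_def b_def)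
  ultimately show ?thesis
    by (simp only: inner_minus_right norm_minus_cancel) (simp add: field_simps)
qed

text \<open>Here \<open>p\<close> and \<open>h\<close> stand for the previous iterate and its
  gradient, \<open>u\<close> for the minimizer, and \<open>Fx\<close>, \<open>Fp\<close>,
  \<open>Fu\<close> for function values. All information about the function sits in
  \<open>sc\<close> and \<open>coco\<close>; the rest is algebra.\<close>

lemma lyapunov_step:
  fixes x p z g h u d :: "'a::real_inner"
    and \<mu> s r \<eta> \<nu> \<tau> \<zeta> A Fx Fp Fu :: real
  assumes "\<mu> > 0" "s > 0" "r > 0" and r2: "r\<^sup>2 = \<mu> * s"
    and "\<eta> \<ge> 0" "\<nu> \<ge> 0" "1 - \<nu> * r > 0" "\<tau> > 0" "\<zeta> \<ge> 0"
    and A: "A = \<zeta> * \<nu> / \<tau>\<^sup>2 * (\<tau> + \<zeta> * \<eta> * r)"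
    and d: "d = x - (p - (\<eta> * s) *\<^sub>R h)" and zx: "z - x = (\<zeta> / (\<tau> * r)) *\<^sub>R d"
    and sc: "Fx + g \<bullet> (u - x) + \<mu> / 2 * (norm (u - x))\<^sup>2 \<le> Fu"
    and coco: "Fx + g \<bullet> (p - x) + \<eta> * s / 2 * (norm (h - g))\<^sup>2 \<le> Fp"
  shows "A * (Fx - Fu - \<eta> * s / 2 * (norm g)\<^sup>2)
      + \<mu> / 2 * (norm ((\<nu> * r) *\<^sub>R (x - (1 / \<mu>) *\<^sub>R g) + (1 - \<nu> * r) *\<^sub>R z - u))\<^sup>2
      - (1 - \<nu> * r) * (A * (Fp - Fu - \<eta> * s / 2 * (norm h)\<^sup>2) + \<mu> / 2 * (norm (z - u))\<^sup>2)
    \<le> \<nu> * r / \<tau>\<^sup>2 * ((\<zeta> * \<nu> * (\<tau> + \<zeta> * \<eta> * r) - \<tau>\<^sup>2) * (Fx - Fu)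
        + r * (\<tau> * (\<nu> * \<tau> - 2 * \<zeta> * \<eta>) + \<zeta> * \<eta> * (\<nu> * \<tau> - \<zeta> * \<eta>) * r) * ((norm g)\<^sup>2 / (2 * \<mu>)))"
    (is "?lhs \<le> ?rhs")
proof -
  define G D c where "G = (norm g)\<^sup>2" and "D = (norm d)\<^sup>2" and "c = g \<bullet> d"
  have s: "s = r\<^sup>2 / \<mu>"
    using r2 \<open>\<mu> > 0\<close> by simp
  have "A \<ge> 0"
    unfolding A using assms by simp
  have "(norm (h - g))\<^sup>2 = (norm h)\<^sup>2 - 2 * (g \<bullet> h) + G"
    by (simp add: G_def power2_norm_eq_inner inner_diff_left inner_diff_right inner_commute)
  moreover have "g \<bullet> (p - x) = \<eta> * s * (g \<bullet> h) - c"
    by (simp add: c_def d inner_diff_right)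
  \<comment> \<open>The two \<open>g \<bullet> h\<close> terms cancel, and the right-hand side
    becomes exactly the combination inside the previous Lyapunov value.\<close>
  ultimately have fp: "Fx - c + \<eta> * s / 2 * G \<le> Fp - \<eta> * s / 2 * (norm h)\<^sup>2"
    using coco by (simp add: right_diff_distrib distrib_left)
  \<comment> \<open>As a function of \<open>d\<close> the left side is maximal at
    \<open>d = (\<eta> * r\<^sup>2 / \<mu>) *\<^sub>R g\<close>; this point gives the shift in the
    square.\<close>
  have square: "\<eta> * r * c - \<mu> / (2 * r) * D \<le> \<eta>\<^sup>2 * r * s / 2 * G"
  proof -
    have "0 \<le> \<mu> / (2 * r) * (norm (d - (\<eta> * r\<^sup>2 / \<mu>) *\<^sub>R g))\<^sup>2"
      using \<open>\<mu> > 0\<close> \<open>r > 0\<close> by simp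
    also have "\<dots> = \<mu> / (2 * r) * D - \<eta> * r * c + \<eta>\<^sup>2 * r * s / 2 * G"
      using \<open>\<mu> > 0\<close> \<open>r > 0\<close>
      unfolding norm_diff_scaleR_square D_def[symmetric] G_def[symmetric] c_def[symmetric] s
      by (simp add: field_simps power2_eq_square)
    finally show ?thesis by simp
  qed
  have "\<mu> / 2 * (norm ((\<nu> * r) *\<^sub>R (x - (1 / \<mu>) *\<^sub>R g) + (1 - \<nu> * r) *\<^sub>R z - u))\<^sup>2
      = (1 - \<nu> * r) * (\<mu> / 2 * (norm (z - u))\<^sup>2)
        + \<nu> * r * (g \<bullet> (u - x) + \<mu> / 2 * (norm (u - x))\<^sup>2)
        - \<nu> * r * (1 - \<nu> * r) * (\<mu> / 2 * (\<zeta> / (\<tau> * r))\<^sup>2 * D + \<zeta> / (\<tau> * r) * c)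
        + (\<nu> * r)\<^sup>2 / (2 * \<mu>) * G"
    unfolding z_step_distance[OF \<open>\<mu> > 0\<close>] zx
    by (simp add: G_def D_def c_def power_mult_distrib power_divide)
  moreover have "\<nu> * r * (g \<bullet> (u - x) + \<mu> / 2 * (norm (u - x))\<^sup>2) \<le> \<nu> * r * (Fu - Fx)"
    using sc \<open>\<nu> \<ge> 0\<close> \<open>r > 0\<close> by (intro mult_left_mono) auto
  moreover have "(1 - \<nu> * r) * (A * (Fx - c + \<eta> * s / 2 * G - Fu))
      \<le> (1 - \<nu> * r) * (A * (Fp - Fu - \<eta> * s / 2 * (norm h)\<^sup>2))"
    using fp \<open>A \<ge> 0\<close> \<open>1 - \<nu> * r > 0\<close> by (intro mult_left_mono) auto
  ultimately have "?lhs \<le> A * (Fx - Fu - \<eta> * s / 2 * G) - \<nu> * r * (Fx - Fu)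
      - (1 - \<nu> * r) * (A * (Fx - c + \<eta> * s / 2 * G - Fu))
      - \<nu> * r * (1 - \<nu> * r) * (\<mu> / 2 * (\<zeta> / (\<tau> * r))\<^sup>2 * D + \<zeta> / (\<tau> * r) * c)
      + (\<nu> * r)\<^sup>2 / (2 * \<mu>) * G"
    unfolding G_def[symmetric] by (simp only: right_diff_distrib distrib_left)
  \<comment> \<open>The first four identities below compare the coefficients of
    \<open>Fx - Fu\<close>, \<open>c\<close>, \<open>D\<close> and \<open>G\<close>, in this
    order.\<close>
  also have "\<dots> = ?rhs + (1 - \<nu> * r) * (\<zeta>\<^sup>2 * \<nu> / \<tau>\<^sup>2)
      * (\<eta> * r * c - \<mu> / (2 * r) * D - \<eta>\<^sup>2 * r * s / 2 * G)"
  proof -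
    have "A - \<nu> * r - (1 - \<nu> * r) * A = \<nu> * r / \<tau>\<^sup>2 * (\<zeta> * \<nu> * (\<tau> + \<zeta> * \<eta> * r) - \<tau>\<^sup>2)"
      using \<open>\<tau> > 0\<close> unfolding A by (simp add: field_simps power2_eq_square)
    moreover have "(1 - \<nu> * r) * A - \<nu> * r * (1 - \<nu> * r) * (\<zeta> / (\<tau> * r))
        = (1 - \<nu> * r) * (\<zeta>\<^sup>2 * \<nu> / \<tau>\<^sup>2) * (\<eta> * r)"
      using \<open>\<tau> > 0\<close> \<open>r > 0\<close> unfolding A by (simp add: field_simps power2_eq_square)
    moreover have "\<nu> * r * (1 - \<nu> * r) * (\<mu> / 2 * (\<zeta> / (\<tau> * r))\<^sup>2)
        = (1 - \<nu> * r) * (\<zeta>\<^sup>2 * \<nu> / \<tau>\<^sup>2) * (\<mu> / (2 * r))"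
      using \<open>\<tau> > 0\<close> \<open>r > 0\<close> by (simp add: field_simps power2_eq_square)
    moreover have "((\<nu> * r)\<^sup>2 / (2 * \<mu>) - A * (\<eta> * s / 2) - (1 - \<nu> * r) * A * (\<eta> * s / 2)) * G
        = \<nu> * r / \<tau>\<^sup>2 * (r * (\<tau> * (\<nu> * \<tau> - 2 * \<zeta> * \<eta>) + \<zeta> * \<eta> * (\<nu> * \<tau> - \<zeta> * \<eta>) * r) * (G / (2 * \<mu>)))
          - (1 - \<nu> * r) * (\<zeta>\<^sup>2 * \<nu> / \<tau>\<^sup>2) * (\<eta>\<^sup>2 * r * s / 2) * G"
      using \<open>\<tau> > 0\<close> \<open>\<mu> > 0\<close> unfolding A s by (simp add: field_simps power2_eq_square)
    \<comment> \<open>The four identities are assembled with every coefficient replaced by a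
      variable, which leaves a division-free polynomial statement.\<close>
    moreover have "a * (Fx - Fu - m * G) - n * (Fx - Fu) - b * (a * (Fx - c + m * G - Fu))
          - n * b * (k * D + l * c) + w * G
        = j * (i * (Fx - Fu) + i' * H) + b * K * (e * c - e' * D - v * G)"
      if "a - n - b * a = j * i" "b * a - n * b * l = b * K * e" "n * b * k = b * K * e'"
        "(w - a * m - b * a * m) * G = j * (i' * H) - b * K * v * G"
      for a n b m k l w j i i' H K e e' v :: real
      using that by algebra
    ultimately show ?thesis
      unfolding G_def[symmetric] by blast
  qed
  also have "\<dots> \<le> ?rhs"
  proof -
    have "(1 - \<nu> * r) * (\<zeta>\<^sup>2 * \<nu> / \<tau>\<^sup>2)
        * (\<eta> * r * c - \<mu> / (2 * r) * D - \<eta>\<^sup>2 * r * s / 2 * G) \<le> 0"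
      using \<open>1 - \<nu> * r > 0\<close> \<open>\<nu> \<ge> 0\<close> square
      by (intro mult_nonneg_nonpos) (simp, linarith)
    then show ?thesis by linarith
  qed
  finally show ?thesis .
qed

section \<open>Sign analysis and application to the iterates\<close>

text \<open>The sign of \<open>I\<close> decides which bound on \<open>F\<close> applies:
  \<open>F \<le> G\<close> if \<open>I > 0\<close>, the lower bound if \<open>II > 0\<close>, where
  \<open>I \<le> 0\<close> is forced. In the last case both terms are nonpositive.\<close>

lemma case_bound_nonpos:
  fixes I II r \<mu> L F G :: real
  assumes "r \<ge> 0" "\<mu> > 0" "L > 0" "G \<ge> 0" and "F \<le> G" and lower: "\<mu> / L * G \<le> F"
    and "I > 0 \<and> I + r * II \<le> 0 \<or> II > 0 \<and> \<mu> / L * I + r * II \<le> 0 \<or> I \<le> 0 \<and> II \<le> 0"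
  shows "I * F + r * II * G \<le> 0"
  using assms(7)
proof (elim disjE conjE)
  assume "I > 0" "I + r * II \<le> 0"
  then have "I * F \<le> I * G" "(I + r * II) * G \<le> 0"
    using \<open>F \<le> G\<close> \<open>G \<ge> 0\<close> by (auto simp: mult_nonpos_nonneg)
  then show ?thesis by (simp add: distrib_right)
next
  assume "II > 0" and le: "\<mu> / L * I + r * II \<le> 0"
  then have "\<mu> / L * I \<le> 0"
    using \<open>r \<ge> 0\<close> mult_nonneg_nonneg[of r II] by linarith
  then have "I \<le> 0"
    using \<open>\<mu> > 0\<close> \<open>L > 0\<close> by (simp add: divide_le_0_iff mult_le_0_iff)
  then have "I * F \<le> I * (\<mu> / L * G)"
    using lower by (intro mult_left_mono_neg)
  moreover have "(\<mu> / L * I + r * II) * G \<le> 0"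
    using le \<open>G \<ge> 0\<close> by (rule mult_nonpos_nonneg)
  ultimately show ?thesis by (simp add: algebra_simps)
next
  assume "I \<le> 0" "II \<le> 0"
  moreover have "F \<ge> 0"
    using lower \<open>\<mu> > 0\<close> \<open>L > 0\<close> \<open>G \<ge> 0\<close> by (intro order_trans[OF _ lower]) simp
  ultimately show ?thesis
    using \<open>r \<ge> 0\<close> \<open>G \<ge> 0\<close> by (intro add_nonpos_nonpos mult_nonpos_nonneg mult_nonneg_nonpos)
qed

theorem lemma3:
  fixes f :: "real ^ 'n \<Rightarrow> real"
    and \<mu> L s q \<eta> \<nu> \<tau> \<zeta> I II :: real
    and x y z :: "nat \<Rightarrow> real ^ 'n"
    and xstar :: "real ^ 'n"
    and V :: "nat \<Rightarrow> real"
    and c1 c2 c3 :: bool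
  assumes "0 < \<mu>" and "\<mu> \<le> L"
    and "f \<in> smooth_strongly_convex \<mu> L"
    and "xstar = arg_min f (\<lambda>_. True)"
    and "s > 0" and "q = \<mu> * s"
    and "0 \<le> \<eta> * s" and "\<eta> * s \<le> 1 / L"
    and "\<nu> \<ge> 0" and "1 - \<nu> * sqrt q > 0"
    and "\<tau> > 0"
    and "\<zeta> = 1 + (1 - \<tau>) * sqrt q" and "\<zeta> \<ge> 0"
    and "I = \<zeta> * \<nu> * (\<tau> + \<zeta> * \<eta> * sqrt q) - \<tau>\<^sup>2"
    and "II = \<tau> * (\<nu> * \<tau> - 2 * \<zeta> * \<eta>) + \<zeta> * \<eta> * (\<nu> * \<tau> - \<zeta> * \<eta>) * sqrt q"
    and "algorithm_A f \<mu> s \<eta> \<nu> \<tau> x y z"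
    and "\<forall>k. V (k + 1) =
           \<zeta> * \<nu> / \<tau>\<^sup>2 * (\<tau> + \<zeta> * \<eta> * sqrt q)
             * (f (x k) - f xstar - \<eta> * s / 2 * (norm (grad f (x k)))\<^sup>2)
           + \<mu> / 2 * (norm (z (k + 1) - xstar))\<^sup>2"
    and "c1 \<longleftrightarrow> I > 0 \<and> I + sqrt q * II \<le> 0"
    and "c2 \<longleftrightarrow> II > 0 \<and> \<mu> / L * I + sqrt q * II \<le> 0"
    and "c3 \<longleftrightarrow> I \<le> 0 \<and> II \<le> 0"
  shows "\<not> (c1 \<and> c2) \<and> \<not> (c1 \<and> c3) \<and> \<not> (c2 \<and> c3) \<and>
    (c1 \<or> c2 \<or> c3 \<longrightarrow> (\<forall>k\<ge>1. V (k + 1) \<le> (1 - \<nu> * sqrt q) * V k))"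
proof -
  define r where "r = sqrt q"
  have "q > 0"
    using assms(1,5,6) by simp
  then have r: "r > 0" "r\<^sup>2 = \<mu> * s"
    using assms(6) by (simp_all add: r_def)
  have "L > 0" "\<eta> \<ge> 0"
    using assms(1,2,5,7) by (simp_all add: zero_le_mult_iff)
  have diff: "f differentiable (at u)"
    and lip: "norm (grad f v - grad f u) \<le> L * norm (v - u)"
    and sc: "f u + grad f u \<bullet> (v - u) + \<mu> / 2 * (norm (v - u))\<^sup>2 \<le> f v" for u v
    using assms(3) by (auto simp: smooth_strongly_convex_def)
  have above_tangent: "f u + grad f u \<bullet> (v - u) \<le> f v" for u v
    using sc[of u v] assms(1) by (smt (verit) divide_pos_pos mult_nonneg_nonneg zero_le_power2)
  have "is_arg_min f (\<lambda>_. True) xstar"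
    using ex1_minimizer[OF assms(1,3)] unfolding assms(4) arg_min_def by (metis someI_ex)
  then have min: "f xstar \<le> f u" for u
    by (simp add: is_arg_min_linorder)
  \<comment> \<open>The other two exclusions are immediate from the signs of \<open>I\<close> and
    \<open>II\<close>.\<close>
  have excl: "\<not> (c1 \<and> c2)"
  proof
    assume "c1 \<and> c2"
    then have "I > 0" "II > 0" "I + r * II \<le> 0"
      using assms(18,19) by (auto simp: r_def)
    then show False
      using \<open>r > 0\<close> mult_pos_pos[of r II] by linarith
  qed
  have step: "V (k + 1) \<le> (1 - \<nu> * sqrt q) * V k" if c: "c1 \<or> c2 \<or> c3" and "k \<ge> 1" for k
  proof -
    \<comment> \<open>The predecessor \<open>j\<close> is essential: \<open>V k\<close> involves
      \<open>x j\<close>, and the update rule for \<open>x\<close> constrains \<open>x k\<close>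
      only for positive \<open>k\<close>.\<close>
    obtain j where k: "k = Suc j"
      using \<open>k \<ge> 1\<close> by (cases k) auto
    define d where "d = x k - (x j - (\<eta> * s) *\<^sub>R grad f (x j))"
    note alg = assms(16)[unfolded algorithm_A_def Let_def assms(6)[symmetric] r_def[symmetric]]
    have zS: "z (k + 1) = (\<nu> * r) *\<^sub>R (x k - (1 / \<mu>) *\<^sub>R grad f (x k)) + (1 - \<nu> * r) *\<^sub>R z k"
      using alg by simp
    have zx: "z k - x k = (\<zeta> / (\<tau> * r)) *\<^sub>R d"
    proof -
      have y: "x k - d = y k"
        using alg by (simp add: d_def k)
      have "x k = (\<tau> * r / (1 + r)) *\<^sub>R z k + (1 - \<tau> * r / (1 + r)) *\<^sub>R (x k - d)"
        unfolding y using alg by (simp add: k)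
      then have "(1 + r) *\<^sub>R x k
          = (1 + r) *\<^sub>R ((\<tau> * r / (1 + r)) *\<^sub>R z k + (1 - \<tau> * r / (1 + r)) *\<^sub>R (x k - d))"
        by simp
      \<comment> \<open>This explains \<open>\<zeta>\<close>: it is \<open>1 + r\<close> times the
        weight of \<open>y k\<close> in the update of \<open>x k\<close>.\<close>
      also have "\<dots> = (\<tau> * r) *\<^sub>R z k + \<zeta> *\<^sub>R (x k - d)"
      proof -
        have "(1 + r) * (\<tau> * r / (1 + r)) = \<tau> * r" "(1 + r) * (1 - \<tau> * r / (1 + r)) = \<zeta>"
          using \<open>r > 0\<close> by (simp_all add: assms(12) r_def[symmetric] field_simps)
        then show ?thesis
          by (simp only: scaleR_add_right scaleR_scaleR)
      qed
      finally have "(\<tau> * r) *\<^sub>R (z k - x k) = \<zeta> *\<^sub>R d"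
        by (simp add: assms(12) r_def[symmetric] algebra_simps)
      then have "(1 / (\<tau> * r)) *\<^sub>R ((\<tau> * r) *\<^sub>R (z k - x k)) = (1 / (\<tau> * r)) *\<^sub>R (\<zeta> *\<^sub>R d)"
        by simp
      then show ?thesis
        using \<open>r > 0\<close> assms(11) by simp
    qed
    \<comment> \<open>The bound \<open>\<eta> * s \<le> 1 / L\<close> weakens the cocoercivity
      constant to the one in the Lyapunov function.\<close>
    have coco: "f (x k) + grad f (x k) \<bullet> (x j - x k)
        + \<eta> * s / 2 * (norm (grad f (x j) - grad f (x k)))\<^sup>2 \<le> f (x j)"
    proof -
      have "\<eta> * s / 2 * (norm (grad f (x j) - grad f (x k)))\<^sup>2
          \<le> 1 / L / 2 * (norm (grad f (x j) - grad f (x k)))\<^sup>2"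
        using assms(8) by (intro mult_right_mono divide_right_mono) auto
      then show ?thesis
        using cocoercivity[OF \<open>L > 0\<close> diff lip above_tangent, of "x k" "x j"]
        by (simp add: mult.commute[of 2])
    qed
    define G where "G = (norm (grad f (x k)))\<^sup>2 / (2 * \<mu>)"
    have "V (k + 1) - (1 - \<nu> * r) * V k
        \<le> \<nu> * r / \<tau>\<^sup>2 * (I * (f (x k) - f xstar) + r * II * G)"
      using lyapunov_step[OF assms(1,5) r \<open>\<eta> \<ge> 0\<close> assms(9)
          assms(10)[folded r_def] assms(11,13) refl d_def zx sc[of "x k" xstar] coco]
        assms(17)[rule_format, of j]
      unfolding assms(17)[rule_format, of k] zS
      by (simp add: k r_def[symmetric] assms(14,15) G_def)
    also have "\<dots> \<le> 0"
    proof -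
      \<comment> \<open>The value after a gradient step of length \<open>1 / L\<close> is still at
        least the minimum.\<close>
      have "\<mu> / L * G \<le> f (x k) - f xstar"
        using gradient_step_decrease[OF \<open>L > 0\<close> diff lip, of "x k"]
          min[of "x k - (1 / L) *\<^sub>R grad f (x k)"] assms(1)
        by (simp add: G_def field_simps)
      moreover have "f (x k) - f xstar \<le> G"
        unfolding G_def using assms(1) sc[of "x k" xstar] by (rule strong_convexity_gap_le)
      ultimately have "I * (f (x k) - f xstar) + r * II * G \<le> 0"
        using c assms(1,18-20) \<open>r > 0\<close> \<open>L > 0\<close>
        by (intro case_bound_nonpos[of r \<mu> L]) (auto simp: r_def G_def)
      then show ?thesis
        using \<open>r > 0\<close> assms(9) by (intro mult_nonneg_nonpos) auto
    qed
    finally show ?thesis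
      by (simp add: r_def)
  qed
  show ?thesis
    using excl step assms(18-20) by auto
qed

end
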